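(* Let $(X,\Sigma,\mu)$ be a complete, $\sigma$-finite measure space and let $(Y,d)$ be a metric space. Let $\ell$ be a von Neumann lifting of $\mu$. Let $\varphi\colon X\to Y$ be an essentially separably valued, measurable map. Then $$\lim_{I\Rightarrow x}\frac{1}{\mu(I)}\int_I d\big(\varphi(z),\varphi(x)\big)\,d\mu(z)=0,\qquad\text{for }\mu\text{-a.e. }x\in X,$$ where the limit is the $\mathcal I^\ell$-limit. In particular, if $\mathbb B$ is a Banach space and $v\colon X\to\mathbb B$ is a strongly measurable map, then $$v(x)=\lim_{I\Rightarrow x}\frac{1}{\mu(I)}\int_I v\,d\mu,\qquad\text{for }\mu\text{-a.e. }x\in X,$$ where the integral is a Bochner integral and the $\mathcal I^\ell$-limit is in the norm topology of $\mathbb B$.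
   Context: Von Neumann lifting: for a measure space $(X,\Sigma,\mu)$ with $\mu\neq 0$, a map $\ell\colon\Sigma\to\Sigma$ is a von Neumann lifting of $\mu$ if (i) $\ell(\varnothing)=\varnothing$, $\ell(X)=X$, $\ell(E\cap F)=\ell(E)\cap\ell(F)$ and $\ell(E\cup F)=\ell(E)\cup\ell(F)$ for all $E,F\in\Sigma$; (ii) $\ell(E)=\ell(F)$ whenever $\mu(E\Delta F)=0$; (iii) $\mu(E\Delta\ell(E))=0$ for every $E\in\Sigma$. Induced differentiation basis: $\mathcal I^\ell:=\{\ell(E): E\in\Sigma,\ 0<\mu(E)<+\infty\}$. For $x\in X$, $\mathcal I^\ell_x:=\{I\in\mathcal I^\ell: x\in I\}$, and $\hat X:=\{x\in X:\mathcal I^\ell_x\neq\varnothing\}$ (a set of full $\mu$-measure). For $x\in\hat X$ and $I\in\mathcal I^\ell_x$, $\mathcal U^\ell_x(I):=\{J\in\mathcal I^\ell_x: J\subset I\}$. $\mathcal I^\ell$-limit: let $x\in\hat X$, let $Z$ be a Hausdorff topological space, and let $\Phi$ be a $Z$-valued map defined at least on $\mathcal U^\ell_x(I_0)$ for some $I_0\in\mathcal I^\ell_x$. One writes $\lim_{I\Rightarrow x}\Phi(I)=z$ if for every open neighbourhood $U$ of $z$ there is $I\in\mathcal I^\ell_x$ (with $I\subset I_0$) such that $\Phi(J)\in U$ for every $J\in\mathcal U^\ell_x(I)$. A measurable map $\varphi\colon X\to Y$ is essentially separably valued if there is $N\in\Sigma$ with $\mu(N)=0$ such that $\varphi(X\setminus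 N)$ is a separable subset of $Y$. A map $v\colon X\to\mathbb B$ is strongly measurable if it is $\mu$-measurable and it is the $\mu$-a.e. limit (in norm) of a sequence of $\mathbb B$-simple maps $\sum_{i=1}^n\mathbf 1_{E_i}v_i$ with $E_i\in\Sigma$ pairwise disjoint, $\mu(E_i)<\infty$, $v_i\in\mathbb B$. It is Bochner integrable over $E\in\Sigma$ if $\int_E\|v\|_{\mathbb B}\,d\mu<\infty$. The second assertion includes that for $\mu$-a.e. $x$ the map $v$ is Bochner integrable over some $I_0\in\mathcal I^\ell_x$, so that the averages are defined for all $I\in\mathcal U^\ell_x(I_0)$. *)

theory Defs
  imports "HOL-Analysis.Analysis"
begin

definition von_neumann_lifting :: "'a measure \<Rightarrow> ('a set \<Rightarrow> 'a set) \<Rightarrow> bool" where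
  "von_neumann_lifting M l \<longleftrightarrow>
     emeasure M (space M) \<noteq> 0 \<and>
     (\<forall>E\<in>sets M. l E \<in> sets M) \<and>
     l {} = {} \<and> l (space M) = space M \<and>
     (\<forall>E\<in>sets M. \<forall>F\<in>sets M. l (E \<inter> F) = l E \<inter> l F) \<and>
     (\<forall>E\<in>sets M. \<forall>F\<in>sets M. l (E \<union> F) = l E \<union> l F) \<and>
     (\<forall>E\<in>sets M. \<forall>F\<in>sets M. emeasure M (sym_diff E F) = 0 \<longrightarrow> l E = l F) \<and>
     (\<forall>E\<in>sets M. emeasure M (sym_diff E (l E)) = 0)"

definition lifting_basis :: "'a measure \<Rightarrow> ('a set \<Rightarrow> 'a set) \<Rightarrow> 'a set set" where
  "lifting_basis M l = {l E | E. E \<in> sets M \<and> 0 < emeasure M E \<and> emeasure M E < \<infinity>}"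

definition lifting_basis_at :: "'a measure \<Rightarrow> ('a set \<Rightarrow> 'a set) \<Rightarrow> 'a \<Rightarrow> 'a set set" where
  "lifting_basis_at M l x = {I \<in> lifting_basis M l. x \<in> I}"

definition lifting_basis_below ::
    "'a measure \<Rightarrow> ('a set \<Rightarrow> 'a set) \<Rightarrow> 'a \<Rightarrow> 'a set \<Rightarrow> 'a set set" where
  "lifting_basis_below M l x I = {J \<in> lifting_basis_at M l x. J \<subseteq> I}"

text \<open>
  The parameter \<open>I0\<close> carries the domain of the map: \<open>\<Phi>\<close> need only be meaningful on
  \<open>lifting_basis_below M l x I0\<close>, and no other values of \<open>\<Phi>\<close> are inspected.
  The existence of \<open>I0 \<in> lifting_basis_at M l x\<close> says that the limit can be
  considered at \<open>x\<close> at all (that is, that \<open>x\<close> lies in some member of the basis).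
\<close>
definition lifting_limit ::
    "'a measure \<Rightarrow> ('a set \<Rightarrow> 'a set) \<Rightarrow> 'a \<Rightarrow> 'a set \<Rightarrow> ('a set \<Rightarrow> 'z::t2_space) \<Rightarrow> 'z \<Rightarrow> bool" where
  "lifting_limit M l x I0 \<Phi> z \<longleftrightarrow>
     I0 \<in> lifting_basis_at M l x \<and>
     (\<forall>U. open U \<and> z \<in> U \<longrightarrow>
        (\<exists>I\<in>lifting_basis_at M l x. I \<subseteq> I0 \<and> (\<forall>J\<in>lifting_basis_below M l x I. \<Phi> J \<in> U)))"

definition essentially_separably_valued :: "'a measure \<Rightarrow> ('a \<Rightarrow> 'y::topological_space) \<Rightarrow> bool" where
  "essentially_separably_valued M \<phi> \<longleftrightarrow>
     (\<exists>N\<in>sets M. emeasure M N = 0 \<and> separable_space (top_of_set (\<phi> ` (space M - N))))"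

definition simple_map :: "'a measure \<Rightarrow> ('a \<Rightarrow> 'b::real_vector) \<Rightarrow> bool" where
  "simple_map M s \<longleftrightarrow>
     (\<exists>(n::nat) E w. (\<forall>i<n. E i \<in> sets M \<and> emeasure M (E i) < \<infinity>) \<and>
        disjoint_family_on E {..<n} \<and>
        (\<forall>x\<in>space M. s x = (\<Sum>i<n. indicator (E i) x *\<^sub>R w i)))"

definition strongly_measurable :: "'a measure \<Rightarrow> ('a \<Rightarrow> 'b::real_normed_vector) \<Rightarrow> bool" where
  "strongly_measurable M v \<longleftrightarrow>
     v \<in> borel_measurable M \<and>
     (\<exists>s. (\<forall>k::nat. simple_map M (s k)) \<and> (AE x in M. (\<lambda>k. s k x) \<longlonglongrightarrow> v x))"

text \<open>
  The library predicate \<open>has_bochner_integral\<close> and the library integral are restricted to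
  second countable target spaces. The following definitions repeat them without that
  restriction; the integral of simple maps is the one of the library, whose simple
  integrable maps are exactly the simple maps above.
\<close>

definition has_banach_integral ::
    "'a measure \<Rightarrow> ('a \<Rightarrow> 'b::real_normed_vector) \<Rightarrow> 'b \<Rightarrow> bool" where
  "has_banach_integral M f b \<longleftrightarrow>
     f \<in> borel_measurable M \<and>
     (\<exists>s. (\<forall>k::nat. simple_map M (s k)) \<and>
        (\<lambda>k. \<integral>\<^sup>+x. ennreal (norm (f x - s k x)) \<partial>M) \<longlonglongrightarrow> 0 \<and>
        (\<lambda>k. Bochner_Integration.simple_bochner_integral M (s k)) \<longlonglongrightarrow> b)"

definition banach_integral :: "'a measure \<Rightarrow> ('a \<Rightarrow> 'b::real_normed_vector) \<Rightarrow> 'b" where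
  "banach_integral M f =
     (if \<exists>b. has_banach_integral M f b then THE b. has_banach_integral M f b else 0)"

definition set_banach_integral :: "'a measure \<Rightarrow> 'a set \<Rightarrow> ('a \<Rightarrow> 'b::real_normed_vector) \<Rightarrow> 'b" where
  "set_banach_integral M E v = banach_integral M (\<lambda>x. indicator E x *\<^sub>R v x)"

definition bochner_integrable_over :: "'a measure \<Rightarrow> 'a set \<Rightarrow> ('a \<Rightarrow> 'b::real_normed_vector) \<Rightarrow> bool" where
  "bochner_integrable_over M E v \<longleftrightarrow>
     E \<in> sets M \<and> strongly_measurable M v \<and> (\<integral>\<^sup>+x\<in>E. ennreal (norm (v x)) \<partial>M) < \<infinity>"

lemma simple_map_iff: "simple_map M s \<longleftrightarrow> Bochner_Integration.simple_bochner_integrable M s"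
proof
  assume "simple_map M s"
  then obtain n E w where E: "\<And>i. i < n \<Longrightarrow> E i \<in> sets M" "\<And>i. i < n \<Longrightarrow> emeasure M (E i) < \<infinity>"
    and s: "\<And>x. x \<in> space M \<Longrightarrow> s x = (\<Sum>i<(n::nat). indicator (E i) x *\<^sub>R w i)"
    unfolding simple_map_def by blast
  let ?t = "\<lambda>x. \<Sum>i<n. indicator (E i) x *\<^sub>R w i"
  have "simple_function M (\<lambda>x. indicator (E i) x *\<^sub>R w i)" if "i < n" for i
    using simple_function_compose1[OF simple_function_indicator[OF E(1)[OF that]], of "\<lambda>r. r *\<^sub>R w i"]
    by simp
  then have t: "simple_function M ?t"
    by (intro simple_function_sum) auto
  have "simple_function M s"
    using t simple_function_cong[of M s ?t] s by simp
  moreover have sub: "{y \<in> space M. s y \<noteq> 0} \<subseteq> (\<Union>i<n. E i)"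
  proof (rule subsetI, rule ccontr)
    fix y assume y: "y \<in> {y \<in> space M. s y \<noteq> 0}" and n: "y \<notin> (\<Union>i<n. E i)"
    have "(\<Sum>i<n. indicator (E i) y *\<^sub>R w i) = 0"
      using n by (intro sum.neutral) auto
    then show False using y s[of y] by auto
  qed
  moreover have fin: "emeasure M (\<Union>i<n. E i) < \<infinity>"
  proof -
    have "emeasure M (\<Union>i<n. E i) \<le> (\<Sum>i<n. emeasure M (E i))"
      using E by (intro emeasure_subadditive_finite) auto
    also have "\<dots> < \<infinity>" using E(2) by simp
    finally show ?thesis .
  qed
  moreover have "emeasure M {y \<in> space M. s y \<noteq> 0} \<le> emeasure M (\<Union>i<n. E i)"
    using E(1) by (intro emeasure_mono[OF sub]) auto
  ultimately have "simple_function M s" "emeasure M {y \<in> space M. s y \<noteq> 0} \<noteq> \<infinity>"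
    by (auto simp: top_unique)
  then show "Bochner_Integration.simple_bochner_integrable M s"
    by (rule Bochner_Integration.simple_bochner_integrable.intros)
next
  assume "Bochner_Integration.simple_bochner_integrable M s"
  then have s: "simple_function M s" and fin: "emeasure M {y \<in> space M. s y \<noteq> 0} \<noteq> \<infinity>"
    by (auto elim: Bochner_Integration.simple_bochner_integrable.cases)
  let ?V = "s ` space M - {0}"
  have finV: "finite ?V" using s by (simp add: simple_function_def)
  then obtain w where w: "bij_betw w {..<card ?V} ?V"
    using ex_bij_betw_nat_finite[of ?V] by (auto simp: atLeast0LessThan)
  let ?n = "card ?V" and ?E = "\<lambda>i. s -` {w i} \<inter> space M"
  have wV: "w i \<in> ?V" if "i < ?n" for i using w that by (auto simp: bij_betw_def)
  have inj: "inj_on w {..<?n}" using w by (auto simp: bij_betw_def)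
  have m: "?E i \<in> sets M" if "i < ?n" for i
    using s wV[OF that] by (auto simp: simple_function_def)
  have sm: "{y \<in> space M. s y \<noteq> 0} \<in> sets M"
  proof -
    have "{y \<in> space M. s y \<noteq> 0} = s -` (- {0}) \<inter> space M" by auto
    also have "\<dots> \<in> sets M" by (rule simple_functionD(2)[OF s])
    finally show ?thesis .
  qed
  have f: "emeasure M (?E i) < \<infinity>" if "i < ?n" for i
  proof -
    have "emeasure M (?E i) \<le> emeasure M {y \<in> space M. s y \<noteq> 0}"
      using wV[OF that] by (intro emeasure_mono sm) auto
    also have "\<dots> < \<infinity>" using fin by (simp add: less_top)
    finally show ?thesis .
  qed
  have d: "disjoint_family_on ?E {..<?n}"
    using inj by (auto simp: disjoint_family_on_def inj_on_def)
  have e: "s x = (\<Sum>i<?n. indicator (?E i) x *\<^sub>R w i)" if x: "x \<in> space M" for x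
  proof -
    have "(\<Sum>i<?n. indicator (?E i) x *\<^sub>R w i) = (\<Sum>i<?n. if s x = w i then w i else 0)"
      using x by (intro sum.cong refl) (simp add: indicator_def)
    also have "\<dots> = (\<Sum>u\<in>?V. if s x = u then u else 0)"
      using sum.reindex_bij_betw[OF w, of "\<lambda>u. if s x = u then u else 0"] by simp
    also have "\<dots> = s x" using finV x by (auto simp: sum.delta')
    finally show ?thesis by simp
  qed
  show "simple_map M s"
    unfolding simple_map_def
    by (intro exI[of _ ?n] exI[of _ ?E] exI[of _ w] conjI allI impI ballI;
        (rule m f d e; assumption))
qed

lemma has_banach_integral_eq_has_bochner_integral:
  fixes f :: "'a \<Rightarrow> 'b::{real_normed_vector, second_countable_topology}"
  shows "has_banach_integral M f b \<longleftrightarrow> has_bochner_integral M f b"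
  unfolding has_banach_integral_def has_bochner_integral.simps simple_map_iff by auto

lemma set_banach_integral_eq_set_lebesgue_integral:
  fixes f :: "'a \<Rightarrow> 'b::{banach, second_countable_topology}"
  shows "set_banach_integral M E f = set_lebesgue_integral M E f"
  unfolding set_banach_integral_def banach_integral_def set_lebesgue_integral_def
    lebesgue_integral_def has_banach_integral_eq_has_bochner_integral ..

end

theory Submission
  imports Defs
begin

text \<open>
  A lifting is monotone, so if \<open>J \<subseteq> l E\<close> is a member of the basis, then almost
  all points of \<open>J\<close> lie in \<open>E\<close>. Apply this to \<open>E = \<phi> -` B \<inter> A\<close>, where \<open>B\<close> is one of countably
  many balls covering the essential range of \<open>\<phi>\<close> and \<open>A\<close> one of countably many sets of finite measure
  covering the space: for almost every \<open>x\<close>, each such \<open>E\<close> containing \<open>x\<close> has \<open>x \<in> l E\<close>,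
  so \<open>l E\<close> is a member of the basis at \<open>x\<close> on which \<open>\<phi>\<close> is almost everywhere close to \<open>\<phi> x\<close>.
  No covering theorem is needed.
\<close>

section \<open>Liftings\<close>

lemma von_neumann_liftingD:
  assumes "von_neumann_lifting M l"
  shows "l {} = {}"
    and "E \<in> sets M \<Longrightarrow> l E \<in> sets M"
    and "E \<in> sets M \<Longrightarrow> F \<in> sets M \<Longrightarrow> l (E \<inter> F) = l E \<inter> l F"
    and "E \<in> sets M \<Longrightarrow> F \<in> sets M \<Longrightarrow> emeasure M (sym_diff E F) = 0 \<Longrightarrow> l E = l F"
    and "E \<in> sets M \<Longrightarrow> emeasure M (sym_diff E (l E)) = 0"
proof -
  note assms[unfolded von_neumann_lifting_def]
  then have *: "l {} = {}" "\<forall>E\<in>sets M. l E \<in> sets M"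
    "\<forall>E\<in>sets M. \<forall>F\<in>sets M. l (E \<inter> F) = l E \<inter> l F"
    "\<forall>E\<in>sets M. \<forall>F\<in>sets M. emeasure M (sym_diff E F) = 0 \<longrightarrow> l E = l F"
    "\<forall>E\<in>sets M. emeasure M (sym_diff E (l E)) = 0"
    by - (elim conjE, assumption)+
  show "l {} = {}"
    by (fact *(1))
  show "E \<in> sets M \<Longrightarrow> l E \<in> sets M"
    by (rule *(2)[rule_format])
  show "E \<in> sets M \<Longrightarrow> F \<in> sets M \<Longrightarrow> l (E \<inter> F) = l E \<inter> l F"
    by (rule *(3)[rule_format])
  show "E \<in> sets M \<Longrightarrow> F \<in> sets M \<Longrightarrow> emeasure M (sym_diff E F) = 0 \<Longrightarrow> l E = l F"
    by (rule *(4)[rule_format])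
  show "E \<in> sets M \<Longrightarrow> emeasure M (sym_diff E (l E)) = 0"
    by (rule *(5)[rule_format])
qed

lemma von_neumann_lifting_AE:
  assumes "von_neumann_lifting M l" "E \<in> sets M"
  shows "l E \<in> sets M" "AE x in M. x \<in> l E \<longleftrightarrow> x \<in> E" "emeasure M (l E) = emeasure M E"
proof -
  show m: "l E \<in> sets M"
    using assms by (rule von_neumann_liftingD)
  have "sym_diff E (l E) \<in> null_sets M"
    using assms(2) m von_neumann_liftingD(5)[OF assms] by (intro null_setsI) auto
  from AE_not_in[OF this] show ae: "AE x in M. x \<in> l E \<longleftrightarrow> x \<in> E"
    by eventually_elim auto
  show "emeasure M (l E) = emeasure M E"
    by (intro emeasure_eq_AE ae m assms)
qed

text \<open>A null set has the same lifting as the empty set, namely \<open>{}\<close>, so the mere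
  presence of a point in \<open>l E\<close> forces \<open>E\<close> to have positive
  measure.\<close>

lemma lifting_in_basis_at:
  assumes l: "von_neumann_lifting M l" and E: "E \<in> sets M" "emeasure M E < \<infinity>" and x: "x \<in> l E"
  shows "l E \<in> lifting_basis_at M l x"
proof -
  have "emeasure M E \<noteq> 0"
  proof
    assume "emeasure M E = 0"
    then have "l E = l {}"
      using E(1) by (intro von_neumann_liftingD(4)[OF l]) auto
    then show False
      using x by (simp add: von_neumann_liftingD(1)[OF l])
  qed
  then show ?thesis
    using E x by (auto simp: lifting_basis_at_def lifting_basis_def zero_less_iff_neq_zero)
qed

section \<open>Members of the basis and limits along them\<close>

lemma lifting_basis_at_imp_basis: "I \<in> lifting_basis_at M l x \<Longrightarrow> I \<in> lifting_basis M l"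
  by (simp add: lifting_basis_at_def)

lemma lifting_basisD:
  assumes "von_neumann_lifting M l" "I \<in> lifting_basis M l"
  shows "I \<in> sets M" "emeasure M I \<noteq> 0" "emeasure M I < \<infinity>"
proof -
  obtain E where "I = l E" "E \<in> sets M" "0 < emeasure M E" "emeasure M E < \<infinity>"
    using assms(2) unfolding lifting_basis_def by blast
  then show "I \<in> sets M" "emeasure M I \<noteq> 0" "emeasure M I < \<infinity>"
    using von_neumann_lifting_AE[OF assms(1), of E] by simp_all
qed

text \<open>Multiplicativity of \<open>l\<close> writes the intersection as the lifting of
  \<open>E \<inter> F\<close>, and the common point \<open>x\<close> supplies positive measure.
  Hence the basis at \<open>x\<close> is directed downwards.\<close>

lemma lifting_basis_at_Int:
  assumes l: "von_neumann_lifting M l"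
    and I: "I \<in> lifting_basis_at M l x" and J: "J \<in> lifting_basis_at M l x"
  shows "I \<inter> J \<in> lifting_basis_at M l x"
proof -
  obtain E F where E: "I = l E" "E \<in> sets M" "emeasure M E < \<infinity>"
    and F: "J = l F" "F \<in> sets M" and x: "x \<in> I" "x \<in> J"
    using I J by (auto simp: lifting_basis_at_def lifting_basis_def)
  have "emeasure M (E \<inter> F) < \<infinity>"
    using E by (intro le_less_trans[OF emeasure_mono[of "E \<inter> F" E]]) auto
  moreover have "l (E \<inter> F) = I \<inter> J"
    using E F by (simp add: von_neumann_liftingD(3)[OF l])
  ultimately show ?thesis
    using lifting_in_basis_at[OF l, of "E \<inter> F" x] E F x by auto
qed

text \<open>Directedness takes care of the condition \<open>I \<subseteq> I0\<close>: a witness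
  \<open>I\<close> found without regard to \<open>I0\<close> is replaced by
  \<open>I \<inter> I0\<close>.\<close>

lemma lifting_limitI:
  assumes l: "von_neumann_lifting M l" and I0: "I0 \<in> lifting_basis_at M l x"
    and *: "\<And>U. open U \<Longrightarrow> z \<in> U \<Longrightarrow>
      \<exists>I\<in>lifting_basis_at M l x. \<forall>J\<in>lifting_basis_below M l x I. \<Phi> J \<in> U"
  shows "lifting_limit M l x I0 \<Phi> z"
  unfolding lifting_limit_def
proof (intro conjI I0 allI impI, elim conjE)
  fix U assume "open U" "z \<in> U"
  from *[OF this] obtain I where I: "I \<in> lifting_basis_at M l x"
    "\<forall>J\<in>lifting_basis_below M l x I. \<Phi> J \<in> U" by blast
  then show "\<exists>I\<in>lifting_basis_at M l x. I \<subseteq> I0 \<and> (\<forall>J\<in>lifting_basis_below M l x I. \<Phi> J \<in> U)"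
    by (intro bexI[OF _ lifting_basis_at_Int[OF l I(1) I0]]) (auto simp: lifting_basis_below_def)
qed

text \<open>Both limits rest on this fact. The bound on \<open>I\<close> is inherited by every
  smaller member \<open>J\<close>, and averaging over \<open>J\<close> preserves it. The null set of
  bad \<open>x\<close> is chosen before \<open>e\<close>; the null set of bad \<open>z\<close> may
  depend on \<open>x\<close> and \<open>e\<close>.\<close>

lemma AE_lifting_basis_at_close:
  fixes \<phi> :: "'a \<Rightarrow> 'y::metric_space"
  assumes M: "sigma_finite_measure M" and l: "von_neumann_lifting M l"
    and \<phi>: "\<phi> \<in> borel_measurable M"
    and C: "countable C" "AE x in M. \<phi> x \<in> closure C"
  shows "AE x in M. \<forall>e>0. \<exists>I\<in>lifting_basis_at M l x. AE z in M. z \<in> I \<longrightarrow> dist (\<phi> z) (\<phi> x) < e"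
proof -
  obtain A :: "nat \<Rightarrow> 'a set" where A: "range A \<subseteq> sets M" "(\<Union>i. A i) = space M"
    "\<And>i. emeasure M (A i) \<noteq> \<infinity>"
    using sigma_finite_measure.sigma_finite[OF M] by blast
  \<comment> \<open>Radii \<open>1 / Suc k\<close> keep the family countable while reaching every
    precision; the factor \<open>A m\<close> makes the measure finite, so that liftings of these
    sets can belong to the basis.\<close>
  define E where "E c k m = \<phi> -` ball c (1 / Suc k) \<inter> space M \<inter> A m" for c and k m :: nat
  have E: "E c k m \<in> sets M" for c k m
    using A(1) measurable_sets[OF \<phi>] by (auto simp: E_def)
  have fin: "emeasure M (E c k m) < \<infinity>" for c k m
  proof -
    have "emeasure M (E c k m) \<le> emeasure M (A m)"
      using A(1) by (intro emeasure_mono) (auto simp: E_def)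
    then show ?thesis using A(3)[of m] by (simp add: less_top order_le_less_trans)
  qed
  \<comment> \<open>Countably many exceptional null sets are merged into one, outside which lifting
    changes no membership of \<open>x\<close> in any \<open>E c k m\<close>.\<close>
  have "AE x in M. \<forall>c\<in>C. \<forall>k m. x \<in> l (E c k m) \<longleftrightarrow> x \<in> E c k m"
    unfolding AE_ball_countable[OF C(1)] AE_all_countable
    using von_neumann_lifting_AE(2)[OF l E] by blast
  with C(2) AE_space show ?thesis
  proof eventually_elim
    case (elim x)
    show ?case
    proof (intro allI impI)
      fix e :: real assume "e > 0"
      \<comment> \<open>Half of \<open>e\<close>, because \<open>\<phi> z\<close> and
        \<open>\<phi> x\<close> are compared through the centre \<open>c\<close>, each within
        \<open>1 / Suc k\<close> of it.\<close>
      then obtain k where k: "1 / Suc k < e / 2"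
        using reals_Archimedean[of "e / 2"] by (auto simp: inverse_eq_divide)
      obtain c where c: "c \<in> C" "dist c (\<phi> x) < 1 / Suc k"
        using elim(1) closure_approachableD[of "\<phi> x" C "1 / Suc k"] by (auto simp: dist_commute)
      obtain m where "x \<in> A m"
        using elim(2) A(2) by blast
      with c elim(2) have "x \<in> E c k m"
        by (simp add: E_def)
      with elim(3) c(1) have "x \<in> l (E c k m)"
        by blast
      then have "l (E c k m) \<in> lifting_basis_at M l x"
        by (rule lifting_in_basis_at[OF l E fin])
      moreover have "AE z in M. z \<in> l (E c k m) \<longrightarrow> dist (\<phi> z) (\<phi> x) < e"
        using von_neumann_lifting_AE(2)[OF l E[of c k m]]
      proof eventually_elim
        case (elim z)
        show ?case
        proof
          assume "z \<in> l (E c k m)"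
          then have "dist c (\<phi> z) < 1 / Suc k"
            using elim by (simp add: E_def)
          then show "dist (\<phi> z) (\<phi> x) < e"
            using c(2) k dist_triangle3[of "\<phi> z" "\<phi> x" c] by linarith
        qed
      qed
      ultimately show "\<exists>I\<in>lifting_basis_at M l x. AE z in M. z \<in> I \<longrightarrow> dist (\<phi> z) (\<phi> x) < e"
        by blast
    qed
  qed
qed

lemma set_nn_integral_le_mult_emeasure:
  assumes "J \<in> sets M" "AE z in M. z \<in> J \<longrightarrow> f z \<le> c"
  shows "(\<integral>\<^sup>+z\<in>J. f z \<partial>M) \<le> c * emeasure M J"
proof -
  have "(\<integral>\<^sup>+z\<in>J. f z \<partial>M) \<le> (\<integral>\<^sup>+z. c * indicator J z \<partial>M)"
    using assms(2) by (intro nn_integral_mono_AE) (auto split: split_indicator)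
  also have "\<dots> = c * emeasure M J"
    using assms(1) by (rule nn_integral_cmult_indicator)
  finally show ?thesis .
qed

section \<open>Strong measurability and the Bochner integral\<close>

text \<open>Density in the subspace topology of the image implies that the closure in the whole
  space covers the image. A countable set whose closure contains almost all values is the common
  form to which the assumptions on \<open>\<phi>\<close> and on \<open>v\<close> are
  reduced.\<close>

lemma essentially_separably_valued_imp_AE_closure:
  assumes "essentially_separably_valued M \<phi>"
  obtains C where "countable C" "AE x in M. \<phi> x \<in> closure C"
proof -
  obtain N where N: "N \<in> null_sets M" and "separable_space (top_of_set (\<phi> ` (space M - N)))"
    using assms by (auto simp: essentially_separably_valued_def)
  then obtain C where C: "countable C"
    "top_of_set (\<phi> ` (space M - N)) closure_of C = \<phi> ` (space M - N)"
    by (auto simp: separable_space_def)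
  have "\<phi> ` (space M - N) \<subseteq> closure C"
    using C(2) closure_of_subtopology_subset[of euclidean "\<phi> ` (space M - N)" C] by auto
  then have "AE x in M. \<phi> x \<in> closure C"
    using AE_not_in[OF N] AE_space by (auto elim!: eventually_elim2)
  with C(1) that show thesis by blast
qed

section \<open>Simple and strongly measurable maps\<close>

lemma simple_map_imp_simple_function: "simple_map M s \<Longrightarrow> simple_function M s"
  by (auto simp: simple_map_iff elim: Bochner_Integration.simple_bochner_integrable.cases)

lemma simple_map_imp_borel_measurable:
  fixes s :: "'a \<Rightarrow> 'b::real_normed_vector"
  shows "simple_map M s \<Longrightarrow> s \<in> borel_measurable M"
  by (intro borel_measurable_simple_function simple_map_imp_simple_function)

text \<open>Each approximating simple map takes finitely many values, so all their values together
  form a countable set, and almost every \<open>v x\<close> is a limit of a sequence in it.\<close>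

lemma strongly_measurable_imp_AE_closure:
  assumes "strongly_measurable M v"
  obtains C where "countable C" "AE x in M. v x \<in> closure C"
proof -
  obtain s where s: "\<And>k::nat. simple_map M (s k)" and lim: "AE x in M. (\<lambda>k. s k x) \<longlonglongrightarrow> v x"
    using assms by (auto simp: strongly_measurable_def)
  let ?C = "\<Union>k. s k ` space M"
  have "finite (s k ` space M)" for k
    using simple_map_imp_simple_function[OF s] by (rule simple_functionD)
  then have "countable ?C"
    by (intro countable_UN) (auto intro: countable_finite)
  moreover have "AE x in M. v x \<in> closure ?C"
    using lim AE_space
  proof eventually_elim
    case (elim x)
    then show ?case
      unfolding closure_sequential by (intro exI[of _ "\<lambda>k. s k x"]) auto
  qed
  ultimately show thesis by (rule that)
qed

text \<open>
  In a space that is not second countable, the difference of two Borel functions need not be Borel.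
  The subtrahend being simple is what makes this work.
\<close>
lemma borel_measurable_norm_diff_simple:
  fixes f :: "'a \<Rightarrow> 'b::real_normed_vector"
  assumes f: "f \<in> borel_measurable M" and s: "simple_function M s"
  shows "(\<lambda>x. norm (f x - s x)) \<in> borel_measurable M"
proof (rule measurable_compose_countable'[where f = "\<lambda>y x. norm (f x - y)" and I = "s ` space M"])
  show "(\<lambda>x. norm (f x - y)) \<in> borel_measurable M" for y
    by (rule borel_measurable_continuous_on[OF _ f]) (intro continuous_intros)
  show "s \<in> measurable M (count_space (s ` space M))"
    using s by (auto simp: measurable_count_space_eq2 simple_function_def)
  show "countable (s ` space M)"
    using simple_functionD(1)[OF s] by (rule countable_finite)
qed

text \<open>Triangle inequality through \<open>f\<close>. It later shows that integrals of simple
  maps approximating \<open>f\<close> in mean form a Cauchy sequence, and that their limit is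
  controlled.\<close>

lemma norm_simple_bochner_integral_diff_le:
  fixes f :: "'a \<Rightarrow> 'b::real_normed_vector"
  assumes f: "f \<in> borel_measurable M" and s: "simple_map M s" and t: "simple_map M t"
  shows "ennreal (norm (Bochner_Integration.simple_bochner_integral M s - Bochner_Integration.simple_bochner_integral M t)) \<le>
    (\<integral>\<^sup>+x. norm (f x - s x) \<partial>M) + (\<integral>\<^sup>+x. norm (f x - t x) \<partial>M)"
proof -
  note s' = s[unfolded simple_map_iff] and t' = t[unfolded simple_map_iff]
  have "norm (Bochner_Integration.simple_bochner_integral M s - Bochner_Integration.simple_bochner_integral M t) =
      norm (Bochner_Integration.simple_bochner_integral M (\<lambda>x. s x - t x))"
    using s' t' by (simp add: simple_bochner_integral_diff)
  also have "\<dots> \<le> Bochner_Integration.simple_bochner_integral M (\<lambda>x. norm (s x - t x))"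
    using simple_bochner_integrable_compose2[of "(-)", OF _ s' t']
    by (intro simple_bochner_integral_norm_bound) simp
  finally have "ennreal (norm (Bochner_Integration.simple_bochner_integral M s - Bochner_Integration.simple_bochner_integral M t)) \<le>
      ennreal (Bochner_Integration.simple_bochner_integral M (\<lambda>x. norm (s x - t x)))"
    by (rule ennreal_leI)
  also have "\<dots> = (\<integral>\<^sup>+x. norm (s x - t x) \<partial>M)"
    using simple_bochner_integrable_compose2[of "\<lambda>x y. norm (x - y)", OF _ s' t']
    by (intro simple_bochner_integral_eq_nn_integral) auto
  also have "\<dots> \<le> (\<integral>\<^sup>+x. ennreal (norm (f x - s x)) + ennreal (norm (f x - t x)) \<partial>M)"
  proof (rule nn_integral_mono)
    fix x
    have "norm (s x - t x) \<le> norm (f x - s x) + norm (f x - t x)"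
      by (metis dual_order.refl norm_diff_triangle_le norm_minus_commute)
    then show "ennreal (norm (s x - t x)) \<le> ennreal (norm (f x - s x)) + ennreal (norm (f x - t x))"
      by (metis ennreal_leI ennreal_plus norm_ge_zero)
  qed
  also have "\<dots> = (\<integral>\<^sup>+x. norm (f x - s x) \<partial>M) + (\<integral>\<^sup>+x. norm (f x - t x) \<partial>M)"
    using borel_measurable_norm_diff_simple[OF f] simple_map_imp_simple_function[OF s] simple_map_imp_simple_function[OF t]
    by (intro nn_integral_add) auto
  finally show ?thesis .
qed

text \<open>The preceding estimate is passed to the limit along a sequence defining
  \<open>b\<close>. Comparing with a simple map in this way replaces linearity of the integral in
  the estimates below.\<close>

lemma has_banach_integral_norm_diff_le:
  fixes f :: "'a \<Rightarrow> 'b::real_normed_vector"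
  assumes f: "has_banach_integral M f b" and t: "simple_map M t"
  shows "ennreal (norm (b - Bochner_Integration.simple_bochner_integral M t)) \<le> (\<integral>\<^sup>+x. norm (f x - t x) \<partial>M)"
proof -
  obtain s where m: "f \<in> borel_measurable M" and s: "\<And>k::nat. simple_map M (s k)"
    and s0: "(\<lambda>k. \<integral>\<^sup>+x. norm (f x - s k x) \<partial>M) \<longlonglongrightarrow> 0"
    and b: "(\<lambda>k. Bochner_Integration.simple_bochner_integral M (s k)) \<longlonglongrightarrow> b"
    using f by (auto simp: has_banach_integral_def)
  have "(\<lambda>k. ennreal (norm (Bochner_Integration.simple_bochner_integral M (s k) - Bochner_Integration.simple_bochner_integral M t)))
      \<longlonglongrightarrow> ennreal (norm (b - Bochner_Integration.simple_bochner_integral M t))"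
    by (intro tendsto_intros b)
  moreover have "(\<lambda>k. (\<integral>\<^sup>+x. norm (f x - s k x) \<partial>M) + (\<integral>\<^sup>+x. norm (f x - t x) \<partial>M))
      \<longlonglongrightarrow> 0 + (\<integral>\<^sup>+x. norm (f x - t x) \<partial>M)"
    by (intro tendsto_add s0 tendsto_const)
  ultimately show ?thesis
    using norm_simple_bochner_integral_diff_le[OF m s t]
    by (intro LIMSEQ_le[where X = "\<lambda>k. ennreal (norm (Bochner_Integration.simple_bochner_integral M (s k) - Bochner_Integration.simple_bochner_integral M t))"])
       auto
qed

text \<open>The simple integrals that converge to \<open>b\<close> must also converge to
  \<open>c\<close>, since their distance to \<open>c\<close> is at most the mean error of the
  approximation.\<close>

lemma has_banach_integral_unique:
  fixes f :: "'a \<Rightarrow> 'b::real_normed_vector"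
  assumes f: "has_banach_integral M f b" and g: "has_banach_integral M f c"
  shows "b = c"
proof -
  obtain s where s: "\<And>k::nat. simple_map M (s k)"
    and s0: "(\<lambda>k. \<integral>\<^sup>+x. norm (f x - s k x) \<partial>M) \<longlonglongrightarrow> 0"
    and b: "(\<lambda>k. Bochner_Integration.simple_bochner_integral M (s k)) \<longlonglongrightarrow> b"
    using f by (auto simp: has_banach_integral_def)
  have "(\<lambda>k. ennreal (norm (c - Bochner_Integration.simple_bochner_integral M (s k)))) \<longlonglongrightarrow> 0"
    using has_banach_integral_norm_diff_le[OF g s]
    by (intro tendsto_sandwich[OF _ _ tendsto_const s0]) auto
  moreover have "(\<lambda>k. ennreal (norm (c - Bochner_Integration.simple_bochner_integral M (s k)))) \<longlonglongrightarrow> ennreal (norm (c - b))"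
    by (intro tendsto_intros b)
  ultimately have "ennreal (norm (c - b)) = 0"
    using LIMSEQ_unique by blast
  then show ?thesis by simp
qed

lemma has_banach_integral_banach_integral:
  assumes "has_banach_integral M f b"
  shows "has_banach_integral M f (banach_integral M f)"
  using assms has_banach_integral_unique[of M f]
  unfolding banach_integral_def by (auto intro: theI2)

text \<open>Truncation of the approximating maps makes dominated convergence applicable. The
  resulting convergence in mean makes the simple integrals Cauchy, and completeness of the target
  gives their limit.\<close>

lemma strongly_measurable_imp_has_banach_integral:
  fixes f :: "'a \<Rightarrow> 'b::banach"
  assumes f: "strongly_measurable M f" and fin: "(\<integral>\<^sup>+x. norm (f x) \<partial>M) < \<infinity>"
  obtains b where "has_banach_integral M f b"
proof -
  obtain t where m[measurable]: "f \<in> borel_measurable M" and t: "\<And>k::nat. simple_map M (t k)"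
    and lim: "AE x in M. (\<lambda>k. t k x) \<longlonglongrightarrow> f x"
    using f by (auto simp: strongly_measurable_def)
  \<comment> \<open>The maps \<open>t k\<close> converge only pointwise and may have large
    integrals. Cutting where they exceed twice the norm of \<open>f\<close> gives the dominating
    function \<open>3 * norm (f x)\<close>.\<close>
  define s where "s k x = (if norm (t k x) \<le> 2 * norm (f x) then t k x else 0)" for k x
  have tm[measurable]: "t k \<in> borel_measurable M" for k
    using t by (rule simple_map_imp_borel_measurable)
  have s: "simple_map M (s k)" for k
  proof -
    have "simple_function M (s k)"
      unfolding s_def using simple_map_imp_simple_function[OF t] by (intro simple_function_If) auto
    moreover have "emeasure M {x \<in> space M. s k x \<noteq> 0} \<le> emeasure M {x \<in> space M. t k x \<noteq> 0}"
      by (intro emeasure_mono) (auto simp: s_def)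
    ultimately show ?thesis
      using t[of k]
      by (auto simp: simple_map_iff Bochner_Integration.simple_bochner_integrable.simps top_unique)
  qed
  have sn: "norm (s k x) \<le> 2 * norm (f x)" for k x
    by (simp add: s_def)
  have bound: "norm (f x - s k x) \<le> 3 * norm (f x)" for k x
    using sn[of k x] norm_triangle_ineq4[of "f x" "s k x"] by linarith
  \<comment> \<open>Where \<open>f x\<close> is nonzero the factor 2 leaves strict room, so the
    truncation is eventually inactive; where \<open>f x = 0\<close> it forces every
    \<open>s k x\<close> to vanish.\<close>
  have s_lim: "(\<lambda>k. s k x) \<longlonglongrightarrow> f x" if x: "(\<lambda>k. t k x) \<longlonglongrightarrow> f x" for x
  proof (cases "f x = 0")
    case True
    then show ?thesis using sn[of _ x] by simp
  next
    case False
    then have "norm (f x) < 2 * norm (f x)"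
      by simp
    from order_tendstoD(2)[OF tendsto_norm[OF x] this]
    have "\<forall>\<^sub>F k in sequentially. s k x = t k x"
      by eventually_elim (simp add: s_def)
    then show ?thesis
      using x tendsto_cong by fastforce
  qed
  have "(\<lambda>k. \<integral>\<^sup>+x. norm (f x - s k x) \<partial>M) \<longlonglongrightarrow> (\<integral>\<^sup>+x. 0 \<partial>M)"
  proof (rule nn_integral_dominated_convergence[where w = "\<lambda>x. ennreal (3 * norm (f x))"])
    show "(\<lambda>x. ennreal (norm (f x - s k x))) \<in> borel_measurable M" for k
      using borel_measurable_norm_diff_simple[OF m simple_map_imp_simple_function[OF s]] by simp
    show "(\<integral>\<^sup>+x. ennreal (3 * norm (f x)) \<partial>M) < \<infinity>"
      using fin by (simp add: ennreal_mult nn_integral_cmult ennreal_mult_less_top)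
    show "AE x in M. ennreal (norm (f x - s k x)) \<le> ennreal (3 * norm (f x))" for k
      using bound by (intro AE_I2 ennreal_leI) auto
    show "AE x in M. (\<lambda>k. ennreal (norm (f x - s k x))) \<longlonglongrightarrow> 0"
      using lim
    proof eventually_elim
      case (elim x)
      from tendsto_diff[OF tendsto_const[of "f x"] s_lim[OF elim]]
      show ?case
        by (simp add: tendsto_norm_zero_iff flip: ennreal_0)
    qed
  qed auto
  then have s0: "(\<lambda>k. \<integral>\<^sup>+x. norm (f x - s k x) \<partial>M) \<longlonglongrightarrow> 0"
    by simp
  have "Cauchy (\<lambda>k. Bochner_Integration.simple_bochner_integral M (s k))"
  proof (rule metric_CauchyI)
    fix e :: real assume "e > 0"
    then have "0 < ennreal (e / 2)"
      by simp
    from order_tendstoD(2)[OF s0 this] obtain K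
      where K: "\<And>k. k \<ge> K \<Longrightarrow> (\<integral>\<^sup>+x. norm (f x - s k x) \<partial>M) < ennreal (e / 2)"
      by (auto simp: eventually_sequentially)
    have "dist (Bochner_Integration.simple_bochner_integral M (s i)) (Bochner_Integration.simple_bochner_integral M (s j)) < e"
      if "i \<ge> K" "j \<ge> K" for i j
    proof -
      have "ennreal (norm (Bochner_Integration.simple_bochner_integral M (s i) - Bochner_Integration.simple_bochner_integral M (s j)))
          < ennreal (e / 2) + ennreal (e / 2)"
        using norm_simple_bochner_integral_diff_le[OF m s s] add_strict_mono[OF K K] that
        by (meson le_less_trans)
      also have "\<dots> = ennreal e"
        using \<open>e > 0\<close> by (simp flip: ennreal_plus)
      finally show ?thesis
        by (simp add: dist_norm ennreal_less_iff)
    qed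
    then show "\<exists>K. \<forall>i\<ge>K. \<forall>j\<ge>K.
        dist (Bochner_Integration.simple_bochner_integral M (s i)) (Bochner_Integration.simple_bochner_integral M (s j)) < e"
      by blast
  qed
  then obtain b where "(\<lambda>k. Bochner_Integration.simple_bochner_integral M (s k)) \<longlonglongrightarrow> b"
    by (auto simp: Cauchy_convergent_iff convergent_def)
  with m s s0 have "has_banach_integral M f b"
    unfolding has_banach_integral_def by blast
  then show thesis by (rule that)
qed

section \<open>Integrals over sets and averages\<close>

lemma indicator_scaleR_simple_map:
  assumes s: "simple_map M s" and E: "E \<in> sets M"
  shows "simple_map M (\<lambda>x. indicator E x *\<^sub>R s x)"
proof -
  have [measurable]: "s \<in> measurable M (count_space UNIV)"
    using simple_map_imp_simple_function[OF s] by (rule measurable_simple_function)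
  have "simple_function M (\<lambda>x. indicator E x *\<^sub>R s x)"
    using E simple_map_imp_simple_function[OF s] by (intro simple_function_compose2[where h = "(*\<^sub>R)"]) auto
  moreover have "emeasure M {x \<in> space M. indicator E x *\<^sub>R s x \<noteq> 0} \<le> emeasure M {x \<in> space M. s x \<noteq> 0}"
    by (intro emeasure_mono) auto
  ultimately show ?thesis
    using s by (auto simp: simple_map_iff Bochner_Integration.simple_bochner_integrable.simps top_unique)
qed

lemma indicator_scaleR_strongly_measurable:
  assumes v: "strongly_measurable M v" and E: "E \<in> sets M"
  shows "strongly_measurable M (\<lambda>x. indicator E x *\<^sub>R v x)"
proof -
  obtain s where m: "v \<in> borel_measurable M" and s: "\<And>k::nat. simple_map M (s k)"
    and lim: "AE x in M. (\<lambda>k. s k x) \<longlonglongrightarrow> v x"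
    using v by (auto simp: strongly_measurable_def)
  \<comment> \<open>As a case distinction on \<open>E\<close> the product is visibly Borel, with no
    joint measurability of scalar multiplication to establish.\<close>
  have "(\<lambda>x. if x \<in> E then v x else 0) \<in> borel_measurable M"
    using m E by (intro measurable_If_set) auto
  also have "(\<lambda>x. if x \<in> E then v x else 0) = (\<lambda>x. indicator E x *\<^sub>R v x)"
    by (auto simp: fun_eq_iff)
  finally have "(\<lambda>x. indicator E x *\<^sub>R v x) \<in> borel_measurable M" .
  moreover have "AE x in M. (\<lambda>k. indicator E x *\<^sub>R s k x) \<longlonglongrightarrow> indicator E x *\<^sub>R v x"
    using lim by eventually_elim (intro tendsto_intros)
  ultimately show ?thesis
    unfolding strongly_measurable_def
    by (intro conjI exI[of _ "\<lambda>k x. indicator E x *\<^sub>R s k x"] allI indicator_scaleR_simple_map s E)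
qed

text \<open>The linear map sending \<open>r\<close> to \<open>r *\<^sub>R c\<close> carries the
  integral of the real indicator to the target space. With \<open>c = v x\<close> this is the map
  against which averages are compared.\<close>

lemma simple_map_indicator_const:
  assumes E: "E \<in> sets M" "emeasure M E < \<infinity>"
  shows "simple_map M (\<lambda>x. indicator E x *\<^sub>R c)"
    and "Bochner_Integration.simple_bochner_integral M (\<lambda>x. indicator E x *\<^sub>R c) = measure M E *\<^sub>R c"
proof -
  have "{x \<in> space M. indicat_real E x \<noteq> 0} = E"
    using sets.sets_into_space[OF E(1)] by (auto split: split_indicator)
  then have i: "Bochner_Integration.simple_bochner_integrable M (indicat_real E)"
    using E by (auto simp: Bochner_Integration.simple_bochner_integrable.simps)
  show "simple_map M (\<lambda>x. indicator E x *\<^sub>R c)"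
    using simple_bochner_integrable_compose2[of "\<lambda>r _. r *\<^sub>R c", OF _ i i] by (simp add: simple_map_iff)
  have "ennreal (Bochner_Integration.simple_bochner_integral M (indicat_real E)) = emeasure M E"
    using simple_bochner_integral_eq_nn_integral[OF i] E by (simp add: ennreal_indicator)
  then have "Bochner_Integration.simple_bochner_integral M (indicat_real E) = measure M E"
    using E(2) by (simp add: emeasure_eq_ennreal_measure)
  then show "Bochner_Integration.simple_bochner_integral M (\<lambda>x. indicator E x *\<^sub>R c) = measure M E *\<^sub>R c"
    using simple_bochner_integral_linear[OF _ i, of "\<lambda>r. r *\<^sub>R c"]
    by simp
qed

text \<open>Supplies integrability over small basis members at \<open>x\<close>, on which
  \<open>v\<close> stays almost everywhere within a fixed distance of \<open>v x\<close>.\<close>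

lemma bochner_integrable_over_bounded:
  assumes v: "strongly_measurable M v" and E: "E \<in> sets M" "emeasure M E < \<infinity>"
    and bound: "AE z in M. z \<in> E \<longrightarrow> norm (v z) \<le> c"
  shows "bochner_integrable_over M E v"
proof -
  have "(\<integral>\<^sup>+z\<in>E. ennreal (norm (v z)) \<partial>M) \<le> ennreal c * emeasure M E"
    using bound by (intro set_nn_integral_le_mult_emeasure E) (auto intro: ennreal_leI)
  also have "\<dots> < \<infinity>"
    using E(2) by (simp add: ennreal_mult_less_top)
  finally show ?thesis
    using v E(1) by (simp add: bochner_integrable_over_def)
qed

text \<open>Guarantees that \<open>set_banach_integral\<close> is a genuine integral here and not
  the default value 0 of \<open>banach_integral\<close>: multiplying by the indicator keeps strong
  measurability, and its norm integral is the finite one over \<open>E\<close>.\<close>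

lemma bochner_integrable_over_imp_has_banach_integral:
  fixes v :: "'a \<Rightarrow> 'b::banach"
  assumes "bochner_integrable_over M E v"
  shows "has_banach_integral M (\<lambda>x. indicator E x *\<^sub>R v x) (set_banach_integral M E v)"
proof -
  have "(\<integral>\<^sup>+x. norm (indicator E x *\<^sub>R v x) \<partial>M) = (\<integral>\<^sup>+x\<in>E. ennreal (norm (v x)) \<partial>M)"
    by (intro nn_integral_cong) (simp split: split_indicator)
  then have "(\<integral>\<^sup>+x. norm (indicator E x *\<^sub>R v x) \<partial>M) < \<infinity>"
    using assms by (simp add: bochner_integrable_over_def)
  then obtain b where "has_banach_integral M (\<lambda>x. indicator E x *\<^sub>R v x) b"
    using assms indicator_scaleR_strongly_measurable[of M v E] strongly_measurable_imp_has_banach_integral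
    by (metis bochner_integrable_over_def)
  then show ?thesis
    unfolding set_banach_integral_def by (rule has_banach_integral_banach_integral)
qed

text \<open>The constant \<open>c\<close> on \<open>E\<close> is a simple map with integral
  \<open>measure M E *\<^sub>R c\<close>. The integral of \<open>v\<close> differs from it by at
  most \<open>e * measure M E\<close>, and division by the positive measure gives the bound.\<close>

lemma norm_set_banach_integral_average_diff_le:
  fixes v :: "'a \<Rightarrow> 'b::banach"
  assumes v: "bochner_integrable_over M E v"
    and E: "emeasure M E \<noteq> 0" "emeasure M E < \<infinity>"
    and e: "0 \<le> e" "AE z in M. z \<in> E \<longrightarrow> norm (v z - c) \<le> e"
  shows "norm ((1 / measure M E) *\<^sub>R set_banach_integral M E v - c) \<le> e"
proof -
  have Em: "E \<in> sets M"
    using v by (simp add: bochner_integrable_over_def)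
  have eq: "emeasure M E = ennreal (measure M E)"
    using E(2) by (simp add: emeasure_eq_ennreal_measure)
  then have pos: "measure M E > 0"
    using E(1) by (simp add: zero_less_measure_iff)
  have "ennreal (norm (set_banach_integral M E v - measure M E *\<^sub>R c))
      \<le> (\<integral>\<^sup>+x. norm (indicator E x *\<^sub>R v x - indicator E x *\<^sub>R c) \<partial>M)"
    using has_banach_integral_norm_diff_le[OF bochner_integrable_over_imp_has_banach_integral[OF v]
        simple_map_indicator_const(1)[OF Em E(2), of c]]
    by (simp add: simple_map_indicator_const(2)[OF Em E(2)])
  also have "\<dots> = (\<integral>\<^sup>+x\<in>E. ennreal (norm (v x - c)) \<partial>M)"
    by (intro nn_integral_cong) (simp split: split_indicator)
  also have "\<dots> \<le> ennreal e * emeasure M E"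
    using e(2) by (intro set_nn_integral_le_mult_emeasure Em) (auto intro: ennreal_leI)
  also have "\<dots> = ennreal (e * measure M E)"
    using e(1) by (simp add: eq ennreal_mult)
  finally have *: "norm (set_banach_integral M E v - measure M E *\<^sub>R c) \<le> e * measure M E"
    using e(1) by simp
  have "(1 / measure M E) *\<^sub>R set_banach_integral M E v - c
      = (1 / measure M E) *\<^sub>R (set_banach_integral M E v - measure M E *\<^sub>R c)"
    using pos by (simp add: scaleR_diff_right)
  also have "norm \<dots> = norm (set_banach_integral M E v - measure M E *\<^sub>R c) / measure M E"
    using pos by simp
  also have "\<dots> \<le> e"
    using * pos by (simp add: divide_le_eq)
  finally show ?thesis .
qed

section \<open>Differentiation along a lifting\<close>

theorem theorem3p4:
  fixes M :: "'a measure"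
    and l :: "'a set \<Rightarrow> 'a set"
    and \<phi> :: "'a \<Rightarrow> 'y::metric_space"
    and v :: "'a \<Rightarrow> 'b::banach"
  assumes "complete_measure M"
    and "sigma_finite_measure M"
    and "von_neumann_lifting M l"
  shows "(\<phi> \<in> borel_measurable M \<and> essentially_separably_valued M \<phi> \<longrightarrow>
            (AE x in M. \<exists>I0\<in>lifting_basis_at M l x.
               lifting_limit M l x I0
                 (\<lambda>I. (\<integral>\<^sup>+z\<in>I. ennreal (dist (\<phi> z) (\<phi> x)) \<partial>M) / emeasure M I) 0))
       \<and> (strongly_measurable M v \<longrightarrow>
            (AE x in M. \<exists>I0\<in>lifting_basis_at M l x.
               bochner_integrable_over M I0 v \<and>
               lifting_limit M l x I0
                 (\<lambda>I. (1 / measure M I) *\<^sub>R set_banach_integral M I v) (v x)))"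
proof (intro conjI impI; (elim conjE)?)
  note l = assms(3)
  assume \<phi>: "\<phi> \<in> borel_measurable M" "essentially_separably_valued M \<phi>"
  obtain C where "countable C" "AE x in M. \<phi> x \<in> closure C"
    using \<phi>(2) by (rule essentially_separably_valued_imp_AE_closure)
  from AE_lifting_basis_at_close[OF assms(2) l \<phi>(1) this]
  show "AE x in M. \<exists>I0\<in>lifting_basis_at M l x. lifting_limit M l x I0
      (\<lambda>I. (\<integral>\<^sup>+z\<in>I. ennreal (dist (\<phi> z) (\<phi> x)) \<partial>M) / emeasure M I) 0"
  proof eventually_elim
    case (elim x)
    obtain I0 where I0: "I0 \<in> lifting_basis_at M l x"
      using elim zero_less_one by blast
    show ?case
    proof (rule bexI[OF _ I0], rule lifting_limitI[OF l I0])
      fix U :: "ennreal set" assume U: "open U" "0 \<in> U"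
      \<comment> \<open>The bound \<open>b\<close> is an extended real and may be infinite, hence
        the next step picks a positive real \<open>e\<close> strictly below it.\<close>
      obtain b where b: "b > 0" "{0..<b} \<subseteq> U"
        using open_right[OF U zero_less_one] by blast
      obtain e where e: "e > 0" "ennreal e < b"
      proof -
        obtain c where c: "0 < c" "c < b"
          using dense[OF b(1)] by blast
        then show thesis
          using that[of "enn2real c"] by (cases c) (auto simp: top_unique)
      qed
      obtain I where I: "I \<in> lifting_basis_at M l x" "AE z in M. z \<in> I \<longrightarrow> dist (\<phi> z) (\<phi> x) < e"
        using elim e(1) by blast
      show "\<exists>I\<in>lifting_basis_at M l x. \<forall>J\<in>lifting_basis_below M l x I.
          (\<integral>\<^sup>+z\<in>J. ennreal (dist (\<phi> z) (\<phi> x)) \<partial>M) / emeasure M J \<in> U"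
      proof (intro bexI[OF _ I(1)] ballI)
        fix J assume "J \<in> lifting_basis_below M l x I"
        then have J: "J \<in> lifting_basis M l" "J \<subseteq> I"
          by (auto simp: lifting_basis_below_def lifting_basis_at_def)
        note J' = lifting_basisD[OF l J(1)]
        have "AE z in M. z \<in> J \<longrightarrow> ennreal (dist (\<phi> z) (\<phi> x)) \<le> ennreal e"
          using I(2) by eventually_elim (use J(2) in \<open>auto intro: ennreal_leI\<close>)
        then have "(\<integral>\<^sup>+z\<in>J. ennreal (dist (\<phi> z) (\<phi> x)) \<partial>M) \<le> ennreal e * emeasure M J"
          by (rule set_nn_integral_le_mult_emeasure[OF J'(1)])
        then have "(\<integral>\<^sup>+z\<in>J. ennreal (dist (\<phi> z) (\<phi> x)) \<partial>M) / emeasure M J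
            \<le> ennreal e * emeasure M J / emeasure M J"
          by (rule divide_right_mono_ennreal)
        \<comment> \<open>Cancellation is legitimate because every basis member has positive finite
          measure.\<close>
        also have "\<dots> = ennreal e"
          using J' by (simp add: ennreal_mult_divide_eq)
        finally show "(\<integral>\<^sup>+z\<in>J. ennreal (dist (\<phi> z) (\<phi> x)) \<partial>M) / emeasure M J \<in> U"
          using b(2) e(2) by auto
      qed
    qed
  qed
next
  note l = assms(3)
  assume v: "strongly_measurable M v"
  then have "v \<in> borel_measurable M"
    by (simp add: strongly_measurable_def)
  moreover obtain C where "countable C" "AE x in M. v x \<in> closure C"
    using v by (rule strongly_measurable_imp_AE_closure)
  ultimately have "AE x in M. \<forall>e>0. \<exists>I\<in>lifting_basis_at M l x.
      AE z in M. z \<in> I \<longrightarrow> dist (v z) (v x) < e"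
    by (rule AE_lifting_basis_at_close[OF assms(2) l])
  then show "AE x in M. \<exists>I0\<in>lifting_basis_at M l x. bochner_integrable_over M I0 v \<and>
      lifting_limit M l x I0 (\<lambda>I. (1 / measure M I) *\<^sub>R set_banach_integral M I v) (v x)"
  proof eventually_elim
    case (elim x)
    \<comment> \<open>Stated for arbitrary \<open>J\<close> and \<open>e\<close>, as it serves both
      \<open>I0\<close> with \<open>e = 1\<close> and the members below \<open>I\<close> with half
      the radius of a ball inside \<open>U\<close>.\<close>
    have int: "bochner_integrable_over M J v"
      if J: "J \<in> lifting_basis M l" and ae: "AE z in M. z \<in> J \<longrightarrow> norm (v z - v x) \<le> e" for J e
    proof (rule bochner_integrable_over_bounded[OF v])
      show "J \<in> sets M" "emeasure M J < \<infinity>"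
        using lifting_basisD[OF l J] by auto
      show "AE z in M. z \<in> J \<longrightarrow> norm (v z) \<le> norm (v x) + e"
        using ae
      proof eventually_elim
        case (elim z)
        then show ?case
          using norm_triangle_sub[of "v z" "v x"] by auto
      qed
    qed
    obtain I0 where I0: "I0 \<in> lifting_basis_at M l x"
      and I0': "AE z in M. z \<in> I0 \<longrightarrow> dist (v z) (v x) < 1"
      using elim zero_less_one by blast
    show ?case
    proof (rule bexI[OF _ I0], rule conjI[OF _ lifting_limitI[OF l I0]])
      show "bochner_integrable_over M I0 v"
        using I0' by (intro int[of _ 1] lifting_basis_at_imp_basis[OF I0])
          (auto simp: dist_norm elim!: eventually_mono)
    next
      fix U :: "'b set" assume "open U" "v x \<in> U"
      then obtain e where e: "e > 0" "ball (v x) e \<subseteq> U"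
        by (meson openE)
      \<comment> \<open>The average inherits only a non-strict bound; halving the radius keeps it
        inside the open ball.\<close>
      then obtain I where I: "I \<in> lifting_basis_at M l x"
        "AE z in M. z \<in> I \<longrightarrow> dist (v z) (v x) < e / 2"
        using elim half_gt_zero by blast
      show "\<exists>I\<in>lifting_basis_at M l x. \<forall>J\<in>lifting_basis_below M l x I.
          (1 / measure M J) *\<^sub>R set_banach_integral M J v \<in> U"
      proof (intro bexI[OF _ I(1)] ballI)
        fix J assume "J \<in> lifting_basis_below M l x I"
        then have J: "J \<in> lifting_basis M l" "J \<subseteq> I"
          by (auto simp: lifting_basis_below_def lifting_basis_at_def)
        have ae: "AE z in M. z \<in> J \<longrightarrow> norm (v z - v x) \<le> e / 2"
          using I(2) by eventually_elim (use J(2) in \<open>auto simp: dist_norm\<close>)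
        have "norm ((1 / measure M J) *\<^sub>R set_banach_integral M J v - v x) \<le> e / 2"
          using lifting_basisD[OF l J(1)] e(1)
          by (intro norm_set_banach_integral_average_diff_le int[OF J(1) ae] ae) auto
        also have "\<dots> < e"
          using e(1) by simp
        finally show "(1 / measure M J) *\<^sub>R set_banach_integral M J v \<in> U"
          using e(2) by (auto simp: dist_norm norm_minus_commute)
      qed
    qed
  qed
qed

end
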